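(* Let $(\mu;\eta_0)$ be a valid inequality for $\mathcal S(A,\mathcal K,\mathcal B)$ and suppose that there exists a linear map $Z:E\to E$ with $Z^*v\in\mathcal K$ for all $v\in\mathcal K$, such that $AZ^*=A$ and $\mu-Z\mu\in\mathcal K^*\setminus\{0\}$. Then $(\mu;\eta_0)$ is not $\mathcal K$-minimal.
   Context: Setting: $E$ is a finite-dimensional Euclidean space with inner product $\langle\cdot,\cdot\rangle$; $\mathcal K\subset E$ is a regular cone (closed, convex, pointed, full-dimensional); $\mathcal K^*=\{y\in E:\langle x,y\rangle\ge0\ \forall x\in\mathcal K\}$ is its dual cone; $A:E\to\mathbb R^m$ is linear; $\mathcal B\subseteq\mathbb R^m$ is an arbitrary nonempty set; $\mathcal S(A,\mathcal K,\mathcal B)=\{x\in\mathcal K: Ax\in\mathcal B\}$, assumed to satisfy $\mathcal S(A,\mathcal K,\mathcal B)\neq\emptyset$ and $\mathcal S(A,\mathcal K,\mathcal B)\ne\mathcal K$. A pair $(\mu;\eta_0)\in E\times\mathbb R$ is a valid inequality if $\langle\mu,x\rangle\ge\eta_0$ for all $x\in \mathcal S(A,\mathcal K,\mathcal B)$. A valid inequality $(\mu;\eta_0)$ with $\mu\neq0$ is $\mathcal K$-minimal if every valid inequality $(\rho;\rho_0)$ with $\rho\ne\mu$ and $\mu-\rho\in\mathcal K^*$ satisfies $\rho_0<\eta_0$. For a linear map $Z:E\to E$, $Z^*$ is the conjugate (adjoint) map: $\langle x,Zv\rangle=\langle Z^*x,v\rangle$ for all $x,v\in E$. *)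

theory Defs
  imports "HOL-Analysis.Analysis"
begin

text \<open>Pointedness means that the cone contains no line; full dimension is expressed by nonempty
  interior, which in particular excludes the empty set (a cone in the sense of the library).\<close>

definition regular_cone :: "'a::euclidean_space set \<Rightarrow> bool" where
  "regular_cone K \<longleftrightarrow>
     cone K \<and> closed K \<and> convex K \<and> K \<inter> uminus ` K = {0} \<and> interior K \<noteq> {}"

definition dual_cone :: "'a::euclidean_space set \<Rightarrow> 'a set" where
  "dual_cone K = {y. \<forall>x\<in>K. x \<bullet> y \<ge> 0}"

definition conic_set ::
  "('a::euclidean_space \<Rightarrow> real ^ 'm) \<Rightarrow> 'a set \<Rightarrow> (real ^ 'm) set \<Rightarrow> 'a set" where
  "conic_set A K B = {x \<in> K. A x \<in> B}"

definition valid_inequality ::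
  "('a::euclidean_space \<Rightarrow> real ^ 'm) \<Rightarrow> 'a set \<Rightarrow> (real ^ 'm) set \<Rightarrow> 'a \<Rightarrow> real \<Rightarrow> bool" where
  "valid_inequality A K B \<mu> \<eta>\<^sub>0 \<longleftrightarrow> (\<forall>x\<in>conic_set A K B. \<mu> \<bullet> x \<ge> \<eta>\<^sub>0)"

definition K_minimal ::
  "('a::euclidean_space \<Rightarrow> real ^ 'm) \<Rightarrow> 'a set \<Rightarrow> (real ^ 'm) set \<Rightarrow> 'a \<Rightarrow> real \<Rightarrow> bool" where
  "K_minimal A K B \<mu> \<eta>\<^sub>0 \<longleftrightarrow>
     valid_inequality A K B \<mu> \<eta>\<^sub>0 \<and> \<mu> \<noteq> 0 \<and>
     (\<forall>\<rho> \<rho>\<^sub>0. valid_inequality A K B \<rho> \<rho>\<^sub>0 \<and> \<rho> \<noteq> \<mu> \<and> \<mu> - \<rho> \<in> dual_cone K \<longrightarrow> \<rho>\<^sub>0 < \<eta>\<^sub>0)"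

end

theory Submission
  imports Defs
begin

text \<open>
  The adjoint \<open>Z\<^sup>*\<close> preserves both the cone \<open>K\<close> and the value of \<open>A\<close>, so it maps the solution set
  into itself. Evaluating a valid inequality \<open>(\<mu>; \<eta>\<^sub>0)\<close> at \<open>Z\<^sup>* x\<close> instead of \<open>x\<close> and moving \<open>Z\<close> to the
  other side of the inner product shows that \<open>(Z \<mu>; \<eta>\<^sub>0)\<close> is valid too. Since \<open>\<mu> - Z \<mu>\<close> is a nonzero
  element of the dual cone, \<open>\<rho> = Z \<mu>\<close> is a competitor of \<open>\<mu>\<close> with the same right-hand side, whereas
  minimality would force its right-hand side to be strictly smaller.
\<close>

lemma valid_inequality_image:
  assumes "linear Z" and "\<And>v. v \<in> K \<Longrightarrow> adjoint Z v \<in> K" and "A \<circ> adjoint Z = A"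
    and "valid_inequality A K B \<mu> \<eta>\<^sub>0"
  shows "valid_inequality A K B (Z \<mu>) \<eta>\<^sub>0"
  unfolding valid_inequality_def
proof
  fix x assume x: "x \<in> conic_set A K B"
  have "A (adjoint Z x) = A x"
    using assms(3) by (metis comp_apply)
  with x assms(2) have "adjoint Z x \<in> conic_set A K B"
    by (simp add: conic_set_def)
  with assms(4) have "\<mu> \<bullet> adjoint Z x \<ge> \<eta>\<^sub>0"
    by (simp add: valid_inequality_def)
  then show "Z \<mu> \<bullet> x \<ge> \<eta>\<^sub>0"
    by (simp add: adjoint_works[OF assms(1)])
qed

theorem proposition2p5:
  fixes K :: "'a::euclidean_space set"
    and A :: "'a \<Rightarrow> real ^ 'm"
    and B :: "(real ^ 'm) set"
    and \<mu> :: 'a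
    and \<eta>\<^sub>0 :: real
  assumes "regular_cone K"
    and "linear A"
    and "B \<noteq> {}"
    and "conic_set A K B \<noteq> {}"
    and "conic_set A K B \<noteq> K"
    and "valid_inequality A K B \<mu> \<eta>\<^sub>0"
    and "\<exists>Z :: 'a \<Rightarrow> 'a. linear Z \<and> (\<forall>v\<in>K. adjoint Z v \<in> K) \<and> A \<circ> adjoint Z = A
           \<and> \<mu> - Z \<mu> \<in> dual_cone K - {0}"
  shows "\<not> K_minimal A K B \<mu> \<eta>\<^sub>0"
proof
  assume minimal: "K_minimal A K B \<mu> \<eta>\<^sub>0"
  from assms(7) obtain Z :: "'a \<Rightarrow> 'a" where Z: "linear Z" "\<And>v. v \<in> K \<Longrightarrow> adjoint Z v \<in> K"
      "A \<circ> adjoint Z = A" and diff: "\<mu> - Z \<mu> \<in> dual_cone K" "\<mu> - Z \<mu> \<noteq> 0"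
    by blast
  have "valid_inequality A K B (Z \<mu>) \<eta>\<^sub>0"
    using Z assms(6) by (rule valid_inequality_image)
  moreover have "Z \<mu> \<noteq> \<mu>"
    using diff(2) by auto
  ultimately have "\<eta>\<^sub>0 < \<eta>\<^sub>0"
    using minimal diff(1) unfolding K_minimal_def by blast
  then show False
    by simp
qed

end
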